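(* Let $M\in\mathbb{R}^{2n\times 2n}$ be a (symmetric) positive definite matrix such that all eigenvalues of $i\sigma M$ are nondegenerate, and let $S\in Sp(2n)$ be the matrix diagonalising $M$ in Williamson's theorem. Let $E\in\mathbb{R}^{2n\times 2n}$ be a symmetric matrix with $\|E\|_\infty=1$, and for $\varepsilon>0$ such that $M+\varepsilon E$ is positive definite put $M_\varepsilon:=M+\varepsilon E$. Then for $\varepsilon>0$ small enough, the matrix $S_\varepsilon\in Sp(2n)$ diagonalising $M_\varepsilon$ in Williamson's theorem can be chosen in such a way that $$\|S-S_\varepsilon\|_\infty<4\left(\sqrt{\kappa(M)}+\frac{\sqrt{n^3\,\|M\|_\infty/\|M^{-1}\|_\infty}}{2\delta}\right)\|M^{-1/2}\|_\infty\,\sqrt{\varepsilon},$$ where $\delta:=\min_{i\ne j}|\lambda_i(i\sigma M)-\lambda_j(i\sigma M)|$, with $\lambda_1(i\sigma M),\dots,\lambda_{2n}(i\sigma M)$ the eigenvalues of $i\sigma M$, and $\kappa(M)$ is the condition number of $M$.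
   Context: Let $\sigma=\begin{pmatrix}0&\mathbb{1}_n\\-\mathbb{1}_n&0\end{pmatrix}\in\mathbb{R}^{2n\times 2n}$ be the standard symplectic form and $Sp(2n)$ the group of real $2n\times 2n$ symplectic matrices ($S^T\sigma S=\sigma$). Williamson's theorem: for every symmetric positive definite $M\in\mathbb{R}^{2n\times 2n}$ there exist $S\in Sp(2n)$ and a diagonal matrix $D\in\mathbb{R}^{n\times n}$ with $D_{11}\ge\dots\ge D_{nn}>0$ such that $S^TMS=\operatorname{diag}(D,D)$; such an $S$ is said to diagonalise $M$. The entries of $D$ are the positive eigenvalues of $i\sigma M$ (the eigenvalues of $i\sigma M$ are $\pm D_{jj}$). $\|\cdot\|_\infty$ denotes the operator norm (largest singular value), and $\kappa(A)=\|A\|_\infty\|A^{-1}\|_\infty$. *)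

theory Defs
  imports
    "HOL-Analysis.Analysis"
    "HOL-Computational_Algebra.Fundamental_Theorem_Algebra"
begin

text \<open>
  Real $2n \times 2n$ matrices are indexed by the sum type \<open>'n + 'n\<close> with \<open>CARD('n) = n\<close>:
  \<open>Inl\<close> is the first and \<open>Inr\<close> the second block of $n$ coordinates. The linear order
  on \<open>'n\<close> only serves to state $D_{11} \ge \dots \ge D_{nn}$.
\<close>

definition block_matrix ::
    "'a^'n^'m \<Rightarrow> 'a^'l^'m \<Rightarrow> 'a^'n^'k \<Rightarrow> 'a^'l^'k \<Rightarrow> 'a^('n + 'l)^('m + 'k)" where
  "block_matrix A B C D = (\<chi> i j.
     case i of
       Inl i' \<Rightarrow> (case j of Inl j' \<Rightarrow> A $ i' $ j' | Inr j' \<Rightarrow> B $ i' $ j')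
     | Inr i' \<Rightarrow> (case j of Inl j' \<Rightarrow> C $ i' $ j' | Inr j' \<Rightarrow> D $ i' $ j'))"

definition symplectic_form :: "real^('n::finite + 'n)^('n + 'n)" where
  "symplectic_form = block_matrix 0 (mat 1) (- mat 1) 0"

definition Sp :: "(real^('n::finite + 'n)^('n + 'n)) set" where
  "Sp = {S. transpose S ** symplectic_form ** S = symplectic_form}"

definition symmetric_mat :: "real^'k^'k \<Rightarrow> bool" where
  "symmetric_mat A \<longleftrightarrow> transpose A = A"

definition pos_def :: "real^'k::finite^'k \<Rightarrow> bool" where
  "pos_def A \<longleftrightarrow> symmetric_mat A \<and> (\<forall>x. x \<noteq> 0 \<longrightarrow> x \<bullet> (A *v x) > 0)"

definition williamson_diagonalises ::
    "real^('n::{finite,linorder} + 'n)^('n + 'n) \<Rightarrow> real^('n + 'n)^('n + 'n) \<Rightarrow> bool" where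
  "williamson_diagonalises S M \<longleftrightarrow> S \<in> Sp \<and>
     (\<exists>D.
        (\<forall>i j. i \<noteq> j \<longrightarrow> D $ i $ j = 0) \<and>
        (\<forall>i j. i \<le> j \<longrightarrow> D $ i $ i \<ge> D $ j $ j) \<and>
        (\<forall>i. D $ i $ i > 0) \<and>
        transpose S ** M ** S = block_matrix D 0 0 D)"

text \<open>The operator norm for the Euclidean norm, i.e. the largest singular value.\<close>

definition opnorm :: "real^'k::finite^'l::finite \<Rightarrow> real" where
  "opnorm A = onorm ((*v) A)"

definition condition_number :: "real^'k::finite^'k \<Rightarrow> real" where
  "condition_number A = opnorm A * opnorm (matrix_inv A)"

text \<open>The unique positive definite square root; only meaningful for positive definite \<open>A\<close>.\<close>

definition pos_def_sqrt :: "real^'k::finite^'k \<Rightarrow> real^'k^'k" where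
  "pos_def_sqrt A = (THE R. pos_def R \<and> R ** R = A)"

definition i_sigma :: "real^('n::finite + 'n)^('n + 'n) \<Rightarrow> complex^('n + 'n)^('n + 'n)" where
  "i_sigma M = map_matrix (\<lambda>x. \<i> * complex_of_real x) (symplectic_form ** M)"

definition charpoly :: "'a::comm_ring_1^'k::finite^'k \<Rightarrow> 'a poly" where
  "charpoly A = det (mat [:0, 1:] - map_matrix (\<lambda>a. [:a:]) A)"

text \<open>
  \<open>lam\<close> enumerates the eigenvalues of \<open>A\<close>, each repeated according to its algebraic multiplicity.
  The enumeration is unique up to a permutation of the indices, and all eigenvalues are
  nondegenerate iff \<open>lam\<close> is injective.
\<close>

definition eigenvalue_enum :: "complex^'k::finite^'k \<Rightarrow> ('k \<Rightarrow> complex) \<Rightarrow> bool" where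
  "eigenvalue_enum A lam \<longleftrightarrow> charpoly A = (\<Prod>i\<in>UNIV. [:- lam i, 1:])"

lemma poly_charpoly:
  fixes A :: "'a::comm_ring_1^'k::finite^'k"
  shows "poly (charpoly A) c = det (mat c - A)"
proof -
  have entry: "poly ((mat [:0, 1:] - map_matrix (\<lambda>a. [:a:]) A) $ i $ j) c = (mat c - A) $ i $ j" for i j
    by (simp add: mat_def)
  have sgn: "poly (of_int k) c = (of_int k :: 'a)" for k
    by (simp add: of_int_poly)
  show ?thesis
    unfolding charpoly_def det_def poly_sum poly_mult poly_prod entry sgn ..
qed

lemma eigenvalue_enum_range:
  fixes A :: "complex^'k::finite^'k"
  assumes "eigenvalue_enum A lam"
  shows "c \<in> range lam \<longleftrightarrow> (\<exists>v. v \<noteq> 0 \<and> A *v v = c *s v)"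
proof -
  have "c \<in> range lam \<longleftrightarrow> poly (charpoly A) c = 0"
    using assms by (auto simp: eigenvalue_enum_def poly_prod)
  also have "\<dots> \<longleftrightarrow> \<not> invertible (mat c - A)"
    by (simp add: poly_charpoly invertible_det_nz)
  also have "\<dots> \<longleftrightarrow> (\<exists>v. v \<noteq> 0 \<and> (mat c - A) *v v = 0)"
    by (metis invertible_left_inverse matrix_left_invertible_ker)
  also have "\<dots> \<longleftrightarrow> (\<exists>v. v \<noteq> 0 \<and> A *v v = c *s v)"
  proof -
    have "mat c *v v = c *s v" for v :: "complex^'k"
      by (simp add: vec_eq_iff matrix_vector_mult_def mat_def if_distrib if_distribR cong: if_cong)
    then show ?thesis
      by (auto simp: matrix_vector_mult_diff_rdistrib)
  qed
  finally show ?thesis .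
qed

lemma charpoly_monic:
  fixes A :: "complex^'k::finite^'k"
  shows "degree (charpoly A) = CARD('k)" and "lead_coeff (charpoly A) = 1"
proof -
  define B where "B = mat [:0, 1:] - map_matrix (\<lambda>a. [:a:]) A"
  define t where "t p = of_int (sign p) * (\<Prod>i\<in>UNIV. B $ i $ p i)" for p
  let ?P = "{p. p permutes (UNIV :: 'k set)}"
  have diag: "B $ i $ i = [:- (A $ i $ i), 1:]" for i
    by (simp add: B_def mat_def)
  have off: "i \<noteq> j \<Longrightarrow> B $ i $ j = [:- (A $ i $ j):]" for i j
    by (simp add: B_def mat_def)
  have tid: "t id = (\<Prod>i\<in>UNIV. [:- (A $ i $ i), 1:])"
    by (simp add: t_def sign_id diag)
  have deg_id: "degree (t id) = CARD('k)"
    unfolding tid by (subst degree_prod_eq_sum_degree) auto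
  have lc_id: "lead_coeff (t id) = 1"
    unfolding tid lead_coeff_prod by simp
  have deg_t: "degree (t p) < CARD('k)" if p: "p \<noteq> id" for p
  proof -
    obtain i0 where i0: "p i0 \<noteq> i0"
      using p by (metis eq_id_iff)
    have "degree (t p) \<le> degree (\<Prod>i\<in>UNIV. B $ i $ p i)"
      unfolding t_def by (rule order_trans[OF degree_mult_le]) (simp add: of_int_poly)
    also have "\<dots> \<le> (\<Sum>i\<in>UNIV. degree (B $ i $ p i))"
      using degree_prod_sum_le[of UNIV "\<lambda>i. B $ i $ p i"] by (simp add: o_def)
    also have "\<dots> < (\<Sum>i\<in>(UNIV :: 'k set). 1)"
    proof (rule sum_strict_mono_ex1)
      show "\<forall>i\<in>UNIV. degree (B $ i $ p i) \<le> 1"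
      proof
        fix i show "degree (B $ i $ p i) \<le> 1"
          by (cases "p i = i") (simp_all add: diag off)
      qed
      show "\<exists>i\<in>UNIV. degree (B $ i $ p i) < 1"
        using i0 by (intro bexI[of _ i0]) (simp_all add: off)
    qed simp
    finally show ?thesis by simp
  qed
  have split: "charpoly A = t id + (\<Sum>p\<in>?P - {id}. t p)"
    unfolding charpoly_def det_def B_def[symmetric] t_def[symmetric]
    by (rule sum.remove) (auto simp: finite_permutations permutes_id)
  have rest: "degree (\<Sum>p\<in>?P - {id}. t p) < CARD('k)"
    by (rule degree_sum_less) (auto intro: deg_t)
  show d: "degree (charpoly A) = CARD('k)"
    unfolding split using rest deg_id by (subst degree_add_eq_left) auto
  show "lead_coeff (charpoly A) = 1"
    unfolding split using rest deg_id lc_id by (metis lead_coeff_add_le add.commute)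
qed

lemma eigenvalue_enum_exists:
  fixes A :: "complex^'k::finite^'k"
  obtains lam where "eigenvalue_enum A lam"
proof -
  have "charpoly A \<noteq> 0"
    using charpoly_monic(2)[of A] by auto
  moreover have "coeff (charpoly A) CARD('k) = 1"
    using charpoly_monic[of A] by simp
  ultimately obtain R where R: "size R = CARD('k)" "charpoly A = (\<Prod>x\<in>#R. [:- x, 1:])"
    using alg_closed_imp_factorization[of "charpoly A"] by (auto simp: charpoly_monic(1))
  obtain xs where xs: "mset xs = R"
    using ex_mset by blast
  have len: "length xs = CARD('k)"
    using R(1) xs by auto
  obtain h :: "'k \<Rightarrow> nat" where h: "bij_betw h UNIV {0..<CARD('k)}"
    using ex_bij_betw_finite_nat[of "UNIV :: 'k set"] by auto
  have "charpoly A = prod_list (map (\<lambda>x. [:- x, 1:]) xs)"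
    using R(2) xs by (metis mset_map prod_mset_prod_list)
  also have "\<dots> = (\<Prod>k\<in>{0..<CARD('k)}. [:- (xs ! k), 1:])"
    by (simp add: prod.list_conv_set_nth len)
  also have "\<dots> = (\<Prod>i\<in>UNIV. [:- (xs ! h i), 1:])"
    using prod.reindex_bij_betw[OF h, of "\<lambda>k. [:- (xs ! k), 1:]"] by simp
  finally show thesis
    by (intro that[of "\<lambda>i. xs ! h i"]) (simp add: eigenvalue_enum_def)
qed

end

theory Submission
  imports Defs
begin

text \<open>
  Write $\sigma$ for \<open>symplectic_form\<close>. The claimed bound is a positive multiple of
  $\sqrt\varepsilon$, so it suffices to choose $S_\varepsilon$ with
  $S - S_\varepsilon = O(\varepsilon)$. After the change of variables by $S$ the matrix $M$ becomes $\Lambda = \mathrm{diag}(D, D)$, and we look for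
  $S_\varepsilon = S X^{-1}$ with $X$ symplectic near the identity and
  $X^T \mathrm{diag}(d, d) X = \Lambda + \varepsilon S^T E S$. Nondegeneracy of the spectrum makes the
  derivative of $(X, d) \mapsto X^T (\mathrm{diag}(d, d) + \sigma) X$ at $(1, D)$ surjective, and Brouwer's
  theorem then yields a solution at distance $O(\varepsilon)$.
\<close>

section \<open>Square roots of positive definite matrices\<close>

text \<open>Maximise the quadratic form of \<open>f\<close> over the unit sphere of \<open>V\<close>.\<close>

lemma selfadjoint_eigenvector:
  fixes f :: "'a::euclidean_space \<Rightarrow> 'a"
  assumes f: "linear f" and adj: "\<And>x y. f x \<bullet> y = x \<bullet> f y"
    and V: "subspace V" "V \<noteq> {0}" "f ` V \<subseteq> V"
  obtains v where "v \<in> V" "norm v = 1" "f v = (v \<bullet> f v) *\<^sub>R v"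
proof -
  let ?S = "V \<inter> sphere 0 1"
  have cont: "continuous_on ?S (\<lambda>x. x \<bullet> f x)"
    by (intro continuous_intros linear_continuous_on) (simp add: f linear_conv_bounded_linear[symmetric])
  obtain u where u: "u \<in> V" "u \<noteq> 0"
    using V subspace_0 by blast
  then have "inverse (norm u) *\<^sub>R u \<in> ?S"
    using V(1) by (simp add: subspace_scale)
  moreover have "compact ?S"
    by (intro closed_Int_compact closed_subspace V) auto
  ultimately obtain v where v: "v \<in> ?S" and max: "\<And>x. x \<in> ?S \<Longrightarrow> x \<bullet> f x \<le> v \<bullet> f v"
    using continuous_attains_sup[OF _ _ cont] by blast
  define l where "l = v \<bullet> f v"
  define w where "w = f v - l *\<^sub>R v"
  have vV: "v \<in> V" and nv: "norm v = 1" and vv: "v \<bullet> v = 1"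
    using v by (auto simp: norm_eq_1)
  have bound: "x \<bullet> f x \<le> l * (x \<bullet> x)" if "x \<in> V" for x
  proof (cases "x = 0")
    case False
    let ?y = "inverse (norm x) *\<^sub>R x"
    have "?y \<in> ?S"
      using False that V(1) by (simp add: subspace_scale)
    from max[OF this] have "(x \<bullet> f x) / (norm x)\<^sup>2 \<le> l"
      by (simp add: l_def linear_cmul[OF f] divide_inverse power2_eq_square algebra_simps)
    then show ?thesis
      using False by (simp add: divide_le_eq power2_norm_eq_inner)
  qed (simp add: linear_0[OF f])
  have wV: "w \<in> V"
    unfolding w_def using V vV by (intro subspace_diff subspace_scale) auto
  have wv: "w \<bullet> v = 0"
    by (simp add: w_def l_def inner_diff_left vv adj)
  have wfv: "w \<bullet> f v = w \<bullet> w"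
    using wv by (simp add: w_def inner_diff_right inner_diff_left)
  have "w = 0"
  proof (rule ccontr)
    assume "w \<noteq> 0"
    then have pos: "0 < w \<bullet> w" by simp
    \<comment> \<open>Moving from \<open>v\<close> to \<open>v + t *\<^sub>R w\<close> gains
      \<open>2 * t * (w \<bullet> w)\<close> to first order and costs at most
      \<open>t * t * c\<close> to second order. The choice of \<open>t\<close> keeps
      \<open>t * c\<close> at most \<open>w \<bullet> w\<close>, so the gain wins; the summand 1
      covers \<open>c = 0\<close>.\<close>
    define c where "c = l * (w \<bullet> w) - w \<bullet> f w"
    have c: "0 \<le> c" using bound[OF wV] by (simp add: c_def)
    define t where "t = (w \<bullet> w) / (c + 1)"
    have t: "0 < t" using pos c by (simp add: t_def)
    have "v + t *\<^sub>R w \<in> V"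
      using V vV wV by (intro subspace_add subspace_scale)
    from bound[OF this] have "2 * t * (w \<bullet> w) \<le> t * t * c"
      using wv wfv adj[of v w]
      by (simp add: c_def linear_add[OF f] linear_cmul[OF f] inner_add_left inner_add_right vv
          l_def[symmetric] inner_commute algebra_simps)
    then have "2 * (w \<bullet> w) \<le> t * c" using t by (simp add: mult.assoc mult.left_commute)
    also have "t * c \<le> w \<bullet> w" using pos c by (simp add: t_def field_simps)
    finally show False using pos by simp
  qed
  then show thesis
    using that[of v] vV nv by (simp add: w_def l_def)
qed

text \<open>Split off one unit eigenvector \<open>v\<close>. By self-adjointness its orthogonal
  complement in \<open>V\<close> is again invariant, and it has smaller dimension. Allowing any
  invariant subspace \<open>V\<close> lets the induction run without restricting
  \<open>f\<close>.\<close>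

lemma selfadjoint_orthonormal_eigenbasis:
  fixes f :: "'a::euclidean_space \<Rightarrow> 'a"
  assumes f: "linear f" and adj: "\<And>x y. f x \<bullet> y = x \<bullet> f y"
    and "subspace V" "f ` V \<subseteq> V"
  shows "\<exists>B \<subseteq> V. pairwise orthogonal B \<and> span B = V \<and>
           (\<forall>b\<in>B. norm b = 1 \<and> f b = (b \<bullet> f b) *\<^sub>R b)"
  using assms(3,4)
proof (induction "dim V" arbitrary: V rule: less_induct)
  case less
  show ?case
  proof (cases "V = {0}")
    case True
    then show ?thesis by (intro exI[of _ "{}"]) auto
  next
    case False
    then obtain v where v: "v \<in> V" "norm v = 1" "f v = (v \<bullet> f v) *\<^sub>R v"
      using selfadjoint_eigenvector[OF f adj] less.prems by blast
    define W where "W = {y \<in> V. orthogonal v y}"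
    have W: "subspace W"
      using less.prems(1) unfolding W_def by (auto simp: subspace_def orthogonal_clauses)
    have "v \<notin> W" using v(2) by (auto simp: W_def orthogonal_def)
    then have "W \<subset> V" using v(1) by (auto simp: W_def)
    then have "dim W < dim V"
      using W less.prems(1) by (metis dim_subset subspace_dim_equal le_neq_trans psubset_eq order_refl)
    moreover have "f ` W \<subseteq> W"
    proof clarsimp
      fix y assume y: "y \<in> W"
      have "v \<bullet> f y = f v \<bullet> y" by (simp add: adj)
      also have "\<dots> = 0" using y by (subst v(3)) (simp add: W_def orthogonal_def)
      finally show "f y \<in> W" using y less.prems by (auto simp: W_def orthogonal_def)
    qed
    ultimately obtain B where B: "B \<subseteq> W" "pairwise orthogonal B" "span B = W"
      "\<forall>b\<in>B. norm b = 1 \<and> f b = (b \<bullet> f b) *\<^sub>R b"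
      using less.hyps[OF _ W] by blast
    have "span (insert v B) = V"
    proof
      show "span (insert v B) \<subseteq> V"
        using v B less.prems by (intro span_minimal) (auto simp: W_def)
      show "V \<subseteq> span (insert v B)"
      proof
        fix x assume x: "x \<in> V"
        have "x - (x \<bullet> v) *\<^sub>R v \<in> W"
          using x v less.prems norm_eq_1[of v]
          by (auto simp: W_def orthogonal_def inner_diff_right inner_commute
              intro: subspace_diff subspace_scale)
        then show "x \<in> span (insert v B)"
          using B(3) by (auto simp: span_insert)
      qed
    qed
    moreover have "pairwise orthogonal (insert v B)"
      using B by (auto simp: pairwise_insert W_def orthogonal_commute)
    ultimately show ?thesis
      using v B by (intro exI[of _ "insert v B"]) (auto simp: W_def)
  qed
qed

lemma symmetric_mat_inner:
  fixes A :: "real^'k::finite^'k"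
  assumes "symmetric_mat A"
  shows "(A *v x) \<bullet> y = x \<bullet> (A *v y)"
  using assms by (metis dot_lmul_matrix symmetric_mat_def transpose_matrix_vector)

lemma symmetric_matI:
  fixes A :: "real^'k::finite^'k"
  assumes "\<And>x y. (A *v x) \<bullet> y = x \<bullet> (A *v y)"
  shows "symmetric_mat A"
proof -
  have "transpose A *v x = A *v x" for x
    using assms by (metis dot_lmul_matrix transpose_matrix_vector vector_eq_rdot)
  then show ?thesis by (simp add: symmetric_mat_def matrix_eq)
qed

text \<open>\<open>P - Q\<close> is symmetric, so it has an eigenbasis. If \<open>b\<close> has
  eigenvalue \<open>m\<close>, then \<open>P *v b\<close> and \<open>Q *v b\<close> have equal
  length, which gives \<open>m * (b \<bullet> (Q *v b) + b \<bullet> (P *v b)) = 0\<close>. The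
  bracket is positive, hence \<open>m = 0\<close>.\<close>

lemma pos_def_sqrt_unique:
  fixes P Q :: "real^'k::finite^'k"
  assumes P: "pos_def P" and Q: "pos_def Q" and eq: "P ** P = Q ** Q"
  shows "P = Q"
proof -
  have sym: "symmetric_mat P" "symmetric_mat Q"
    using P Q by (auto simp: pos_def_def)
  let ?D = "\<lambda>x. P *v x - Q *v x"
  have D: "linear ?D" by (intro linear_compose_sub) auto
  have "?D x \<bullet> y = x \<bullet> ?D y" for x y
    by (simp add: inner_diff_left inner_diff_right symmetric_mat_inner[OF sym(1)] symmetric_mat_inner[OF sym(2)])
  then obtain B where B: "span B = UNIV" "\<And>b. b \<in> B \<Longrightarrow> norm b = 1 \<and> ?D b = (b \<bullet> ?D b) *\<^sub>R b"
    using selfadjoint_orthonormal_eigenbasis[OF D _ subspace_UNIV] by (metis subset_UNIV)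
  have "?D b = 0" if "b \<in> B" for b
  proof -
    define m where "m = b \<bullet> ?D b"
    have b: "b \<noteq> 0" and m: "P *v b = Q *v b + m *\<^sub>R b"
      using B(2)[OF that] by (auto simp: m_def algebra_simps)
    have "(P *v b) \<bullet> (P *v b) = (Q *v b) \<bullet> (Q *v b)"
      using eq by (simp add: symmetric_mat_inner[OF sym(1)] symmetric_mat_inner[OF sym(2)] matrix_vector_mul_assoc)
    then have "m * (b \<bullet> (Q *v b)) + m * (b \<bullet> (P *v b)) = 0"
      by (simp add: m inner_add_left inner_add_right inner_commute algebra_simps)
    then have "m * (b \<bullet> (Q *v b) + b \<bullet> (P *v b)) = 0" by (simp add: algebra_simps)
    moreover have "0 < b \<bullet> (Q *v b) + b \<bullet> (P *v b)"
      using P Q b by (auto simp: pos_def_def intro: add_pos_pos)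
    ultimately show ?thesis using m by simp
  qed
  then have "?D x = 0" for x
    using linear_eq_0_on_span[OF D, of B x] B(1) by auto
  then show ?thesis by (simp add: matrix_eq)
qed

text \<open>In an orthonormal eigenbasis of \<open>A\<close>, take the map \<open>g\<close> that
  scales each basis vector by the square root of its eigenvalue.\<close>

lemma pos_def_sqrt_exists:
  fixes A :: "real^'k::finite^'k"
  assumes A: "pos_def A"
  shows "\<exists>R. pos_def R \<and> R ** R = A"
proof -
  have sym: "symmetric_mat A" using A by (auto simp: pos_def_def)
  obtain B where orth: "pairwise orthogonal B" and span: "span B = UNIV"
    and B: "\<And>b. b \<in> B \<Longrightarrow> norm b = 1 \<and> A *v b = (b \<bullet> (A *v b)) *\<^sub>R b"
    using selfadjoint_orthonormal_eigenbasis[of "(*v) A" UNIV] symmetric_mat_inner[OF sym] by auto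
  have "0 \<notin> B" using B by force
  then have fin: "finite B"
    using orth pairwise_orthogonal_imp_finite by blast
  define l where "l b = sqrt (b \<bullet> (A *v b))" for b
  have l: "0 < l b" if "b \<in> B" for b
  proof -
    have "b \<noteq> 0" using B[OF that] by auto
    then show ?thesis using A by (simp add: l_def pos_def_def)
  qed
  define g where "g x = (\<Sum>b\<in>B. (l b * (b \<bullet> x)) *\<^sub>R b)" for x
  have g: "linear g"
    unfolding g_def by (intro linear_compose_sum ballI) (auto intro!: linearI simp: algebra_simps)
  have gv: "matrix g *v x = g x" for x
    by (simp add: matrix_works g)
  have gb: "g b = l b *\<^sub>R b" if b: "b \<in> B" for b
  proof -
    have "c \<bullet> b = (if c = b then 1 else 0)" if "c \<in> B" for c
      using that b orth B by (auto simp: pairwise_def orthogonal_def norm_eq_1)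
    then have "g b = (\<Sum>c\<in>B. if c = b then l c *\<^sub>R c else 0)"
      unfolding g_def by (intro sum.cong) auto
    then show ?thesis using b fin by simp
  qed
  have form: "g x \<bullet> y = (\<Sum>b\<in>B. l b * (b \<bullet> x) * (b \<bullet> y))" for x y
    by (simp add: g_def inner_sum_left)
  have "symmetric_mat (matrix g)"
  proof (rule symmetric_matI)
    fix x y
    have "g x \<bullet> y = g y \<bullet> x"
      unfolding form by (intro sum.cong refl) (simp add: ac_simps)
    then show "(matrix g *v x) \<bullet> y = x \<bullet> (matrix g *v y)"
      by (simp add: gv inner_commute)
  qed
  moreover have "0 < x \<bullet> g x" if "x \<noteq> 0" for x
  proof (rule ccontr)
    have nn: "0 \<le> l b * (b \<bullet> x) * (b \<bullet> x)" if "b \<in> B" for b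
      using l[OF that] by (simp add: mult.assoc)
    assume "\<not> 0 < x \<bullet> g x"
    then have "(\<Sum>b\<in>B. l b * (b \<bullet> x) * (b \<bullet> x)) \<le> 0"
      using form[of x x] by (simp add: inner_commute)
    then have "(\<Sum>b\<in>B. l b * (b \<bullet> x) * (b \<bullet> x)) = 0"
      using sum_nonneg[of B, OF nn] by (rule antisym)
    \<comment> \<open>Every term of a vanishing sum of nonnegative terms is zero, and
      \<open>l b\<close> is positive. Thus \<open>x\<close> is orthogonal to a spanning set, and so
      to itself.\<close>
    then have "\<forall>b\<in>B. orthogonal x b"
      using nn l fin by (subst (asm) sum_nonneg_eq_0_iff) (force simp: orthogonal_def inner_commute)+
    then have "orthogonal x x"
      using orthogonal_to_span[of x B x] span by auto
    then show False using that by (simp add: orthogonal_def)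
  qed
  moreover have "matrix g ** matrix g = A"
  proof -
    have "g (g x) = A *v x" for x
    proof (rule linear_eq_on_span[of "\<lambda>x. g (g x)" "(*v) A" B])
      show "linear (\<lambda>x. g (g x))" using linear_compose[OF g g] by (simp add: o_def)
      fix b assume b: "b \<in> B"
      have "g (g b) = (l b * l b) *\<^sub>R b" using gb[OF b] by (simp add: linear_cmul[OF g])
      also have "\<dots> = A *v b"
        using B[OF b] l[OF b] by (simp add: l_def)
      finally show "g (g b) = A *v b" .
    qed (auto simp: span)
    then show ?thesis by (simp add: matrix_eq matrix_vector_mul_assoc[symmetric] gv)
  qed
  ultimately show ?thesis
    by (intro exI[of _ "matrix g"]) (simp add: pos_def_def gv)
qed

lemma pos_def_sqrt:
  fixes A :: "real^'k::finite^'k"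
  assumes "pos_def A"
  shows "pos_def (pos_def_sqrt A)" and "pos_def_sqrt A ** pos_def_sqrt A = A"
proof -
  have "\<exists>!R. pos_def R \<and> R ** R = A"
    using pos_def_sqrt_exists[OF assms] pos_def_sqrt_unique by metis
  from theI'[OF this] show "pos_def (pos_def_sqrt A)" "pos_def_sqrt A ** pos_def_sqrt A = A"
    unfolding pos_def_sqrt_def by auto
qed

section \<open>Inverses and operator norms of positive definite matrices\<close>

lemma pos_def_invertible:
  fixes A :: "real^'k::finite^'k"
  assumes "pos_def A"
  shows "invertible A"
  using assms unfolding invertible_left_inverse matrix_left_invertible_ker pos_def_def
  by (metis inner_zero_right less_irrefl)

lemma pos_def_matrix_inv:
  fixes A :: "real^'k::finite^'k"
  assumes A: "pos_def A"
  shows "pos_def (matrix_inv A)"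
proof -
  have inv: "A ** matrix_inv A = mat 1"
    using someI_ex[OF pos_def_invertible[OF A, unfolded invertible_def]] by (simp add: matrix_inv_def)
  then have Ai: "A *v (matrix_inv A *v x) = x" for x
    by (simp add: matrix_vector_mul_assoc)
  have sym: "symmetric_mat A" using A by (auto simp: pos_def_def)
  have "symmetric_mat (matrix_inv A)"
    by (rule symmetric_matI) (metis Ai symmetric_mat_inner[OF sym])
  moreover have "0 < x \<bullet> (matrix_inv A *v x)" if "x \<noteq> 0" for x
  proof -
    have "matrix_inv A *v x \<noteq> 0" using Ai[of x] that by auto
    then have "0 < (matrix_inv A *v x) \<bullet> (A *v (matrix_inv A *v x))"
      using A by (auto simp: pos_def_def)
    then show ?thesis by (simp add: Ai inner_commute)
  qed
  ultimately show ?thesis by (simp add: pos_def_def)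
qed

lemma opnorm_pos_def_pos:
  fixes A :: "real^'k::finite^'k"
  assumes "pos_def A"
  shows "0 < opnorm A"
proof -
  have "axis undefined 1 \<noteq> (0 :: real^'k)" by (simp add: axis_eq_0_iff)
  then have "A *v axis undefined 1 \<noteq> 0"
    using assms unfolding pos_def_def by (metis inner_zero_right less_irrefl)
  then show ?thesis
    unfolding opnorm_def by (subst onorm_pos_lt) (auto simp: linear_conv_bounded_linear[symmetric])
qed

section \<open>Local solvability with a linear bound\<close>

text \<open>If \<open>g\<close> is a linear right inverse of the derivative, then a fixed point \<open>y\<close> of
  \<open>y \<mapsto> b - (f (x\<^sub>0 + g y) - f x\<^sub>0 - y)\<close>, supplied by Brouwer's theorem, solves
  \<open>f (x\<^sub>0 + g y) = f x\<^sub>0 + b\<close>.\<close>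

lemma local_surjectivity_linear_bound:
  fixes f :: "'a::euclidean_space \<Rightarrow> 'b::euclidean_space"
  assumes cont: "continuous_on UNIV f" and der: "(f has_derivative f') (at x\<^sub>0)" and surj: "surj f'"
  shows "\<exists>C>0. \<exists>\<eta>>0. \<forall>b. norm b \<le> \<eta> \<longrightarrow> (\<exists>x. norm (x - x\<^sub>0) \<le> C * norm b \<and> f x = f x\<^sub>0 + b)"
proof -
  have "linear f'"
    using der by (rule has_derivative_linear)
  then obtain g where g: "linear g" "f' \<circ> g = id"
    using linear_surjective_right_inverse surj by blast
  have fg: "f' (g y) = y" for y
    using g(2) by (metis comp_apply id_apply)
  obtain B where B: "0 < B" "\<And>y. norm (g y) \<le> B * norm y"
    using linear_bounded_pos[OF g(1)] by blast
  \<comment> \<open>For \<open>norm y \<le> 2 * norm b\<close> the point \<open>g y\<close> has norm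
    at most \<open>2 * B * norm b\<close>. The factor \<open>1 / (2 * B)\<close> therefore bounds
    the linearisation error by \<open>norm b\<close>, and the map \<open>h\<close> below sends the
    ball of radius \<open>2 * norm b\<close> into itself.\<close>
  obtain d where d: "0 < d"
    "\<And>x. norm (x - x\<^sub>0) < d \<Longrightarrow> norm (f x - f x\<^sub>0 - f' (x - x\<^sub>0)) \<le> 1 / (2 * B) * norm (x - x\<^sub>0)"
  proof -
    have "0 < 1 / (2 * B)" using B(1) by simp
    then show thesis
      using der that unfolding has_derivative_at_alt by blast
  qed
  \<comment> \<open>The threshold \<open>d / (4 * B)\<close> keeps \<open>norm (g y)\<close> at most
    \<open>d / 2\<close>, within the range of the derivative estimate.\<close>
  have "\<exists>x. norm (x - x\<^sub>0) \<le> 2 * B * norm b \<and> f x = f x\<^sub>0 + b" if b: "norm b \<le> d / (4 * B)" for b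
  proof -
    define h where "h y = b - (f (x\<^sub>0 + g y) - f x\<^sub>0 - y)" for y
    have gsmall: "norm (g y) \<le> 2 * B * norm b" if "norm y \<le> 2 * norm b" for y
      using order_trans[OF B(2)[of y] mult_left_mono[OF that, of B]] B(1) by (simp add: mult_ac)
    have "h y \<in> cball 0 (2 * norm b)" if y: "y \<in> cball 0 (2 * norm b)" for y
    proof -
      have "2 * B * norm b \<le> d / 2"
        using b B(1) by (simp add: field_simps)
      then have "norm (g y) < d"
        using gsmall[of y] y d(1) by simp
      then have "norm (f (x\<^sub>0 + g y) - f x\<^sub>0 - y) \<le> 1 / (2 * B) * norm (g y)"
        using d(2)[of "x\<^sub>0 + g y"] by (simp add: fg)
      also have "\<dots> \<le> 1 / (2 * B) * (2 * B * norm b)"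
        using gsmall[of y] y B(1) by (intro mult_left_mono) auto
      also have "\<dots> = norm b" using B(1) by simp
      finally show ?thesis
        using norm_triangle_ineq4[of b "f (x\<^sub>0 + g y) - f x\<^sub>0 - y"] by (simp add: h_def)
    qed
    moreover have "continuous_on (cball 0 (2 * norm b)) h"
      unfolding h_def
      by (intro continuous_intros continuous_on_compose2[OF cont] linear_continuous_on)
        (auto simp: g linear_conv_bounded_linear[symmetric])
    ultimately obtain y where y: "y \<in> cball 0 (2 * norm b)" "h y = y"
      using brouwer[of "cball 0 (2 * norm b)" h] by auto
    then have "f (x\<^sub>0 + g y) = f x\<^sub>0 + b"
      by (simp add: h_def algebra_simps)
    then show "\<exists>x. norm (x - x\<^sub>0) \<le> 2 * B * norm b \<and> f x = f x\<^sub>0 + b"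
      using gsmall[of y] y(1) by (intro exI[of _ "x\<^sub>0 + g y"]) auto
  qed
  moreover have "0 < 2 * B" "0 < d / (4 * B)"
    using B(1) d(1) by simp_all
  ultimately show ?thesis by blast
qed

section \<open>The linearised equation\<close>

text \<open>Parametrised by the vector of diagonal entries rather than by a matrix, so that the
  unknowns \<open>(X, d)\<close> range over a Euclidean space and every \<open>d\<close> is
  admissible.\<close>

definition double_diag :: "real^'n \<Rightarrow> real^('n::finite + 'n)^('n + 'n)" where
  "double_diag d = block_matrix (\<chi> i j. if i = j then d $ i else 0) 0 0 (\<chi> i j. if i = j then d $ i else 0)"

lemma double_diag_nth [simp]:
  "double_diag d $ Inl i $ Inl j = (if i = j then d $ i else 0)"
  "double_diag d $ Inl i $ Inr j = 0"
  "double_diag d $ Inr i $ Inl j = 0"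
  "double_diag d $ Inr i $ Inr j = (if i = j then d $ i else 0)"
  by (simp_all add: double_diag_def block_matrix_def)

lemma symplectic_form_nth [simp]:
  "symplectic_form $ Inl i $ Inl j = 0"
  "symplectic_form $ Inl i $ Inr j = (if i = j then 1 else 0)"
  "symplectic_form $ Inr i $ Inl j = (if i = j then - 1 else 0)"
  "symplectic_form $ Inr i $ Inr j = 0"
  by (simp_all add: symplectic_form_def block_matrix_def mat_def)

lemma sum_UNIV_Plus:
  "sum f (UNIV :: ('a::finite + 'b::finite) set) = (\<Sum>i\<in>UNIV. f (Inl i)) + (\<Sum>i\<in>UNIV. f (Inr i))"
  by (subst UNIV_Plus_UNIV[symmetric]) (simp add: sum.Plus del: UNIV_Plus_UNIV)

lemma matrix_eq_sumI:
  assumes "\<And>i j. A $ Inl i $ Inl j = B $ Inl i $ Inl j" "\<And>i j. A $ Inl i $ Inr j = B $ Inl i $ Inr j"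
    "\<And>i j. A $ Inr i $ Inl j = B $ Inr i $ Inl j" "\<And>i j. A $ Inr i $ Inr j = B $ Inr i $ Inr j"
  shows "A = B"
proof -
  have "A $ i $ j = B $ i $ j" for i j
    using assms by (cases i; cases j) auto
  then show ?thesis by (simp add: vec_eq_iff)
qed

text \<open>Cramer's rule for the matrix with rows \<open>(a, b)\<close> and \<open>(b, a)\<close>.
  The two denominators have opposite signs so that exchanging \<open>a\<close> and \<open>b\<close>
  carries one component into the other; one formula then defines an unknown at both
  \<open>(j, k)\<close> and \<open>(k, j)\<close>.\<close>

lemma solve_two_by_two:
  fixes a b p q :: real
  assumes "a\<^sup>2 \<noteq> b\<^sup>2"
  shows "a * ((a * p - b * q) / (a\<^sup>2 - b\<^sup>2)) + b * ((b * p - a * q) / (b\<^sup>2 - a\<^sup>2)) = p"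
    and "b * ((a * p - b * q) / (a\<^sup>2 - b\<^sup>2)) + a * ((b * p - a * q) / (b\<^sup>2 - a\<^sup>2)) = q"
proof -
  have eq: "(b * p - a * q) / (b\<^sup>2 - a\<^sup>2) = (a * q - b * p) / (a\<^sup>2 - b\<^sup>2)"
    using minus_divide_divide[of "a * q - b * p" "a\<^sup>2 - b\<^sup>2"] by simp
  have nz: "a\<^sup>2 - b\<^sup>2 \<noteq> 0" using assms by simp
  have "a * (a * p - b * q) + b * (a * q - b * p) = p * (a\<^sup>2 - b\<^sup>2)"
    "b * (a * p - b * q) + a * (a * q - b * p) = q * (a\<^sup>2 - b\<^sup>2)"
    by (simp_all add: power2_eq_square algebra_simps)
  then show "a * ((a * p - b * q) / (a\<^sup>2 - b\<^sup>2)) + b * ((b * p - a * q) / (b\<^sup>2 - a\<^sup>2)) = p"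
    "b * ((a * p - b * q) / (a\<^sup>2 - b\<^sup>2)) + a * ((b * p - a * q) / (b\<^sup>2 - a\<^sup>2)) = q"
    using nz unfolding eq by (simp_all add: add_divide_distrib[symmetric])
qed

text \<open>The entries with indices \<open>(j, k)\<close> and \<open>(k, j)\<close> form a closed system, which splits into
  two systems of size two with determinant \<open>(D j)\<^sup>2 - (D k)\<^sup>2\<close>, one for \<open>y1\<close>, \<open>y4\<close> and one
  for \<open>y2\<close>, \<open>y3\<close>.\<close>

lemma linearised_equation_entries:
  fixes D :: "'n \<Rightarrow> real" and B1 B2 B3 B4 :: "'n \<Rightarrow> 'n \<Rightarrow> real"
  assumes pos: "\<And>i. 0 < D i" and "inj D"
  obtains y1 y2 y3 y4 d where
    "\<And>j k. D k * y1 k j - y3 k j + D j * y1 j k + y3 j k + (if j = k then d j else 0) = B1 j k"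
    "\<And>j k. y1 k j + D k * y3 k j + D j * y2 j k + y4 j k = B2 j k"
    "\<And>j k. D k * y2 k j - y4 k j + D j * y3 j k - y1 j k = B3 j k"
    "\<And>j k. y2 k j + D k * y4 k j + D j * y4 j k - y2 j k + (if j = k then d j else 0) = B4 j k"
proof -
  \<comment> \<open>Adding and subtracting the equations at \<open>(j, k)\<close> and
    \<open>(k, j)\<close> decouples them. Off the diagonal, \<open>s\<close> and \<open>u\<close>
    are the right-hand sides for \<open>y1 j k\<close>, \<open>y1 k j\<close>, and \<open>v\<close>,
    \<open>w\<close> those for \<open>y3 k j\<close>, \<open>y2 j k\<close>. \<open>t j k\<close> is
    the required value of \<open>y1 k j + y4 j k\<close>, while \<alpha> and \<beta> are those of
    \<open>y3 j k - y3 k j\<close> and \<open>y2 k j - y2 j k\<close>.\<close>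
  define s where "s j k = (B1 j k + B1 k j) / 2" for j k
  define t where "t j k = (B2 j k - B3 k j) / 2" for j k
  define u where "u j k = D k * t k j + D j * t j k - (B4 j k + B4 k j) / 2" for j k
  define v where "v j k = (B2 j k + B3 k j) / 2" for j k
  define \<alpha> where "\<alpha> j k = (B1 j k - B1 k j) / 2" for j k
  define \<beta> where "\<beta> j k = (B4 j k - B4 k j) / 2" for j k
  define w where "w j k = v k j - D j * \<alpha> j k - D k * \<beta> j k" for j k
  \<comment> \<open>For \<open>j = k\<close> the determinant vanishes, and the shift
    \<open>d\<close> makes up for it. Adding the first and fourth equations, with
    \<open>y1 j j + y4 j j = t j j\<close>, determines \<open>d j\<close>. Only
    \<open>y2 j j + y3 j j\<close> is determined, so \<open>y3 j j\<close> is set to zero.\<close>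
  define d where "d j = (B1 j j + B4 j j) / 2 - D j * t j j" for j
  define y1 where "y1 j k = (if j = k then (B1 j j - d j) / (2 * D j)
    else (D j * s j k - D k * u j k) / ((D j)\<^sup>2 - (D k)\<^sup>2))" for j k
  define y4 where "y4 j k = t j k - y1 k j" for j k
  define y2 where "y2 j k = (if j = k then v j j / D j
    else (D j * v j k - D k * w j k) / ((D j)\<^sup>2 - (D k)\<^sup>2))" for j k
  define y3 where "y3 j k = (if j = k then 0
    else (D j * v k j - D k * w k j) / ((D j)\<^sup>2 - (D k)\<^sup>2))" for j k
  have sq: "(D j)\<^sup>2 \<noteq> (D k)\<^sup>2" if "j \<noteq> k" for j k
    using that \<open>inj D\<close> pos[of j] pos[of k] by (auto simp: power2_eq_iff dest: injD)
  have nz: "D j \<noteq> 0" for j using pos[of j] by simp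
  have sym: "s k j = s j k" "u k j = u j k" for j k
    by (simp_all add: s_def u_def)
  have f1: "D j * y1 j k + D k * y1 k j = s j k" "D k * y1 j k + D j * y1 k j = u j k" if "j \<noteq> k" for j k
    using that solve_two_by_two[OF sq[OF that], of "s j k" "u j k"]
    by (simp_all add: y1_def sym[of k j])
  have f3: "D k * y3 k j + D j * y2 j k = v j k" if "j \<noteq> k" for j k
    using that solve_two_by_two(1)[OF sq[OF that], of "v j k" "w j k"]
    by (simp add: y3_def y2_def)
  have f4: "y3 j k - y3 k j = \<alpha> j k" "y2 k j - y2 j k = \<beta> j k" if "j \<noteq> k" for j k
  proof -
    define m where "m = (D j)\<^sup>2 - (D k)\<^sup>2"
    have m: "m \<noteq> 0" "(D k)\<^sup>2 - (D j)\<^sup>2 = - m" using sq[OF that] by (simp_all add: m_def)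
    have vw: "v k j = w j k + D j * \<alpha> j k + D k * \<beta> j k" "w k j = v j k + D k * \<alpha> j k + D j * \<beta> j k"
      by (simp_all add: w_def \<alpha>_def \<beta>_def field_simps)
    have "y3 j k - y3 k j = (D j * v k j - D k * w k j + (D k * v j k - D j * w j k)) / m"
      using that by (simp add: y3_def m m_def[symmetric] add_divide_distrib)
    also have "D j * v k j - D k * w k j + (D k * v j k - D j * w j k) = \<alpha> j k * m"
      by (simp add: vw m_def power2_eq_square algebra_simps)
    finally show "y3 j k - y3 k j = \<alpha> j k" using m by simp
    have "y2 k j - y2 j k = - (D k * v k j - D j * w k j + (D j * v j k - D k * w j k)) / m"
      using that by (simp add: y2_def m m_def[symmetric] add_divide_distrib diff_divide_distrib)
    also have "- (D k * v k j - D j * w k j + (D j * v j k - D k * w j k)) = \<beta> j k * m"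
      by (simp add: vw m_def power2_eq_square algebra_simps)
    finally show "y2 k j - y2 j k = \<beta> j k" using m by simp
  qed
  have diag: "2 * D j * y1 j j + d j = B1 j j" "D j * y2 j j = v j j" for j
    using nz[of j] by (simp_all add: y1_def y2_def)
  show thesis
  proof (rule that[of y1 y3 d y2 y4])
    fix j k
    show "D k * y1 k j - y3 k j + D j * y1 j k + y3 j k + (if j = k then d j else 0) = B1 j k"
    proof (cases "j = k")
      case False
      then show ?thesis using f1(1)[OF False] f4(1)[OF False] unfolding s_def \<alpha>_def by simp
    qed (use diag(1)[of k] in simp)
    show "y1 k j + D k * y3 k j + D j * y2 j k + y4 j k = B2 j k"
    proof (cases "j = k")
      case False
      then show ?thesis using f3[OF False] by (simp add: y4_def t_def v_def field_simps)
    next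
      case True
      then show ?thesis using diag(2)[of k] by (simp add: y3_def y4_def t_def v_def diff_divide_distrib add_divide_distrib)
    qed
    show "D k * y2 k j - y4 k j + D j * y3 j k - y1 j k = B3 j k"
    proof (cases "j = k")
      case False
      then show ?thesis using f3[OF False[symmetric]] by (simp add: y4_def t_def v_def field_simps)
    next
      case True
      then show ?thesis using diag(2)[of k] by (simp add: y3_def y4_def t_def v_def diff_divide_distrib add_divide_distrib)
    qed
    show "y2 k j + D k * y4 k j + D j * y4 j k - y2 j k + (if j = k then d j else 0) = B4 j k"
    proof (cases "j = k")
      case False
      then show ?thesis using f1(2)[OF False] f4(2)[OF False]
        by (simp add: y4_def u_def \<beta>_def field_simps)
    next
      case True
      then show ?thesis using diag(1)[of k] d_def[of k] by (simp add: y4_def field_simps)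
    qed
  qed
qed

text \<open>The left-hand side is the derivative of
  \<open>transpose X ** (double_diag d + symplectic_form) ** X\<close> at \<open>(mat 1, D)\<close>
  in direction \<open>(Y, d)\<close>. The lemma is thus the surjectivity that the local solvability
  argument asks for.\<close>

lemma linearised_equation:
  fixes D :: "real^'n::finite" and B :: "real^('n + 'n)^('n + 'n)"
  assumes "\<And>i. 0 < D $ i" and "inj (($) D)"
  shows "\<exists>Y d. transpose Y ** (double_diag D + symplectic_form)
    + (double_diag D + symplectic_form) ** Y + double_diag d = B"
proof -
  obtain y1 y2 y3 y4 d where y:
    "\<And>j k. D $ k * y1 k j - y3 k j + D $ j * y1 j k + y3 j k + (if j = k then d j else 0) = B $ Inl j $ Inl k"
    "\<And>j k. y1 k j + D $ k * y3 k j + D $ j * y2 j k + y4 j k = B $ Inl j $ Inr k"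
    "\<And>j k. D $ k * y2 k j - y4 k j + D $ j * y3 j k - y1 j k = B $ Inr j $ Inl k"
    "\<And>j k. y2 k j + D $ k * y4 k j + D $ j * y4 j k - y2 j k + (if j = k then d j else 0) = B $ Inr j $ Inr k"
    by (rule linearised_equation_entries[OF assms, of "\<lambda>j k. B $ Inl j $ Inl k" "\<lambda>j k. B $ Inl j $ Inr k"
      "\<lambda>j k. B $ Inr j $ Inl k" "\<lambda>j k. B $ Inr j $ Inr k"])
      (rule that; assumption)
  define Y where "Y = block_matrix (\<chi> j k. y1 j k) (\<chi> j k. y2 j k) (\<chi> j k. y3 j k) (\<chi> j k. y4 j k)"
  have Y: "Y $ Inl j $ Inl k = y1 j k" "Y $ Inl j $ Inr k = y2 j k"
    "Y $ Inr j $ Inl k = y3 j k" "Y $ Inr j $ Inr k = y4 j k" for j k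
    by (simp_all add: Y_def block_matrix_def)
  have "transpose Y ** (double_diag D + symplectic_form)
    + (double_diag D + symplectic_form) ** Y + double_diag (\<chi> i. d i) = B"
    by (rule matrix_eq_sumI, unfold y[symmetric])
      (simp_all add: matrix_matrix_mult_def sum_UNIV_Plus transpose_def Y 
        if_distrib[of "\<lambda>x. x * c" for c] if_distrib[of "(*) c" for c] cong: if_cong)
  then show ?thesis by blast
qed

section \<open>Symplectic matrices\<close>

lemma bounded_bilinear_matrix_mult:
  "bounded_bilinear ((**) :: real^'n::finite^'m::finite \<Rightarrow> real^'l::finite^'n \<Rightarrow> real^'l^'m)"
proof -
  have "bilinear ((**) :: real^'n^'m \<Rightarrow> real^'l^'n \<Rightarrow> real^'l^'m)"
    unfolding bilinear_def
    by (auto intro!: linearI simp: matrix_matrix_mult_def vec_eq_iff algebra_simps sum.distrib sum_distrib_left)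
  then show ?thesis by (simp add: bilinear_conv_bounded_bilinear)
qed

lemmas matrix_mult_simps =
  bounded_bilinear.add_left[OF bounded_bilinear_matrix_mult]
  bounded_bilinear.add_right[OF bounded_bilinear_matrix_mult]
  bounded_bilinear.diff_left[OF bounded_bilinear_matrix_mult]
  bounded_bilinear.diff_right[OF bounded_bilinear_matrix_mult]
  bounded_bilinear.minus_left[OF bounded_bilinear_matrix_mult]
  bounded_bilinear.minus_right[OF bounded_bilinear_matrix_mult]
  bounded_bilinear.scaleR_left[OF bounded_bilinear_matrix_mult]
  bounded_bilinear.scaleR_right[OF bounded_bilinear_matrix_mult]

lemma linear_transpose: "linear (transpose :: real^'n^'m \<Rightarrow> real^'m^'n)"
  by (rule linearI) (simp_all add: transpose_def vec_eq_iff)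

lemmas transpose_simps =
  linear_add[OF linear_transpose] linear_diff[OF linear_transpose] linear_cmul[OF linear_transpose]
  linear_neg[OF linear_transpose]

lemma linear_double_diag: "linear double_diag"
  by (rule linearI; rule matrix_eq_sumI) simp_all

lemma transpose_double_diag [simp]: "transpose (double_diag d) = double_diag d"
  by (rule matrix_eq_sumI) (auto simp: transpose_def)

lemma transpose_symplectic_form [simp]: "transpose symplectic_form = - symplectic_form"
  by (rule matrix_eq_sumI) (auto simp: transpose_def)

lemma symplectic_form_square: "symplectic_form ** symplectic_form = - mat 1"
  by (rule matrix_eq_sumI)
    (auto simp: matrix_matrix_mult_def sum_UNIV_Plus mat_def if_distrib[of "\<lambda>x. x * c" for c] cong: if_cong)

text \<open>Multiplying the defining equation of \<open>Sp\<close> by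
  \<open>- symplectic_form\<close> from the left shows that this is the inverse. Unlike a general
  inverse it is linear in \<open>X\<close>, which later turns a bound on \<open>X - mat 1\<close>
  directly into one on \<open>S - S\<^sub>\<epsilon>\<close>.\<close>

definition symplectic_inverse :: "real^('n::finite + 'n)^('n + 'n) \<Rightarrow> real^('n + 'n)^('n + 'n)" where
  "symplectic_inverse X = - (symplectic_form ** transpose X ** symplectic_form)"

lemma
  assumes "X \<in> Sp"
  shows symplectic_inverse_left: "symplectic_inverse X ** X = mat 1"
    and symplectic_inverse_right: "X ** symplectic_inverse X = mat 1"
proof -
  have "symplectic_inverse X ** X = - (symplectic_form ** (transpose X ** symplectic_form ** X))"
    by (simp add: symplectic_inverse_def matrix_mult_simps matrix_mul_assoc)
  also have "\<dots> = mat 1"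
    using assms by (simp add: Sp_def symplectic_form_square)
  finally show *: "symplectic_inverse X ** X = mat 1" .
  then show "X ** symplectic_inverse X = mat 1"
    by (simp add: matrix_left_right_inverse)
qed

lemma transpose_mult_inverse_cancel:
  fixes X R :: "real^'k::finite^'k"
  assumes "transpose X ** A ** X = B" and "X ** R = mat 1"
  shows "transpose R ** B ** R = A"
proof -
  have "transpose R ** B ** R = transpose (X ** R) ** A ** (X ** R)"
    unfolding assms(1)[symmetric] by (simp add: matrix_transpose_mul matrix_mul_assoc)
  then show ?thesis using assms(2) by simp
qed

lemma symplectic_inverse_Sp:
  assumes "X \<in> Sp"
  shows "symplectic_inverse X \<in> Sp"
  using transpose_mult_inverse_cancel[OF _ symplectic_inverse_right[OF assms], of symplectic_form symplectic_form] assms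
  by (simp add: Sp_def)

lemma Sp_mult:
  assumes "S \<in> Sp" "T \<in> Sp"
  shows "S ** T \<in> Sp"
proof -
  have "transpose (S ** T) ** symplectic_form ** (S ** T)
      = transpose T ** (transpose S ** symplectic_form ** S) ** T"
    by (simp add: matrix_transpose_mul matrix_mul_assoc)
  then show ?thesis using assms by (simp add: Sp_def)
qed

text \<open>Closure of the group under transposition: the left inverse of a square matrix is also a
  right inverse.\<close>

lemma Sp_transpose:
  assumes "S \<in> Sp"
  shows "S ** symplectic_form ** transpose S = symplectic_form"
proof -
  have "- (S ** symplectic_form ** transpose S ** symplectic_form) = mat 1"
    using symplectic_inverse_right[OF assms]
    by (simp add: symplectic_inverse_def matrix_mult_simps matrix_mul_assoc)
  then have "- (S ** symplectic_form ** transpose S ** symplectic_form) ** symplectic_form = symplectic_form"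
    by simp
  then show ?thesis
    by (simp add: matrix_mult_simps matrix_mul_assoc[symmetric] symplectic_form_square)
qed

section \<open>Perturbation of a diagonal normal form\<close>

text \<open>For \<open>B\<close> symmetric, the symmetric and the antisymmetric part of the single equation
  \<open>X\<^sup>T (double_diag d + \<sigma>) X = double_diag D + \<sigma> + B\<close> are the diagonalisation of
  \<open>double_diag D + B\<close> by the inverse of \<open>X\<close> and the condition that \<open>X\<close> is symplectic.\<close>

lemma symplectic_diagonalisation_perturbation:
  fixes D :: "real^'n::finite"
  assumes "\<And>i. 0 < D $ i" and "inj (($) D)"
  shows "\<exists>C>0. \<exists>\<eta>>0. \<forall>B :: real^('n + 'n)^('n + 'n). symmetric_mat B \<and> norm B \<le> \<eta> \<longrightarrow>
    (\<exists>X d. norm (X - mat 1) \<le> C * norm B \<and> norm (d - D) \<le> C * norm B \<and> X \<in> Sp \<and>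
      transpose X ** double_diag d ** X = double_diag D + B)"
proof -
  let ?\<sigma> = "symplectic_form :: real^('n + 'n)^('n + 'n)"
  define f where "f p = transpose (fst p) ** (double_diag (snd p) + ?\<sigma>) ** fst p"
    for p :: "(real^('n + 'n)^('n + 'n)) \<times> (real^'n)"
  have der: "(f has_derivative (\<lambda>h. transpose (fst p) ** (double_diag (snd p) + ?\<sigma>) ** fst h
      + (transpose (fst p) ** double_diag (snd h) + transpose (fst h) ** (double_diag (snd p) + ?\<sigma>)) ** fst p)) (at p)"
    for p :: "(real^('n + 'n)^('n + 'n)) \<times> (real^'n)"
  proof -
    have "linear (\<lambda>p :: (real^('n + 'n)^('n + 'n)) \<times> (real^'n). transpose (fst p))"
      "linear (\<lambda>p :: (real^('n + 'n)^('n + 'n)) \<times> (real^'n). double_diag (snd p))"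
      using linear_compose[OF linear_fst linear_transpose] linear_compose[OF linear_snd linear_double_diag]
      by (simp_all add: o_def)
    then have 1: "((\<lambda>p :: (real^('n + 'n)^('n + 'n)) \<times> (real^'n). transpose (fst p)) has_derivative (\<lambda>h. transpose (fst h))) (at p)"
      and 2: "((\<lambda>p :: (real^('n + 'n)^('n + 'n)) \<times> (real^'n). double_diag (snd p) + ?\<sigma>) has_derivative (\<lambda>h. double_diag (snd h))) (at p)"
      by (auto simp: linear_conv_bounded_linear intro!: has_derivative_add_const bounded_linear_imp_has_derivative)
    show ?thesis
      unfolding f_def
      by (intro bounded_bilinear.FDERIV[OF bounded_bilinear_matrix_mult] 1 2 has_derivative_fst has_derivative_ident)
  qed
  have cont: "continuous_on UNIV f"
    using has_derivative_continuous[OF der] by (simp add: continuous_at_imp_continuous_on)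
  have surj: "surj (\<lambda>h. transpose (mat 1) ** (double_diag D + ?\<sigma>) ** fst h
      + (transpose (mat 1) ** double_diag (snd h) + transpose (fst h) ** (double_diag D + ?\<sigma>)) ** mat 1)"
    unfolding surj_def
  proof
    fix B
    obtain Y d where "transpose Y ** (double_diag D + ?\<sigma>) + (double_diag D + ?\<sigma>) ** Y + double_diag d = B"
      using linearised_equation[OF assms] by blast
    then show "\<exists>h. B = transpose (mat 1) ** (double_diag D + ?\<sigma>) ** fst h
      + (transpose (mat 1) ** double_diag (snd h) + transpose (fst h) ** (double_diag D + ?\<sigma>)) ** mat 1"
      by (intro exI[of _ "(Y, d)"]) (simp add: algebra_simps)
  qed
  obtain C \<eta> where C: "0 < C" and \<eta>: "0 < \<eta>"
    and sol: "\<And>b. norm b \<le> \<eta> \<Longrightarrow> \<exists>p. norm (p - (mat 1, D)) \<le> C * norm b \<and> f p = f (mat 1, D) + b"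
    using local_surjectivity_linear_bound[OF cont der[of "(mat 1, D)", unfolded fst_conv snd_conv] surj]
    by blast
  have "\<exists>X d. norm (X - mat 1) \<le> C * norm B \<and> norm (d - D) \<le> C * norm B \<and> X \<in> Sp \<and>
      transpose X ** double_diag d ** X = double_diag D + B"
    if B: "symmetric_mat B" "norm B \<le> \<eta>" for B :: "real^('n + 'n)^('n + 'n)"
  proof -
    obtain p where p: "norm (p - (mat 1, D)) \<le> C * norm B" "f p = f (mat 1, D) + B"
      using sol[OF B(2)] by blast
    define X where "X = fst p"
    define d where "d = snd p"
    define P where "P = transpose X ** double_diag d ** X"
    define Q where "Q = transpose X ** ?\<sigma> ** X"
    have PQ: "P + Q = double_diag D + B + ?\<sigma>"
      using p(2) by (simp add: f_def P_def Q_def X_def d_def matrix_mult_simps)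
    have "transpose P = P" "transpose Q = - Q"
      by (simp_all add: P_def Q_def matrix_transpose_mul matrix_mul_assoc matrix_mult_simps)
    then have "P - Q = transpose (P + Q)"
      by (simp add: transpose_simps)
    also have "\<dots> = double_diag D + B - ?\<sigma>"
      using B(1) unfolding PQ by (simp add: transpose_simps symmetric_mat_def)
    finally have PQ': "P - Q = double_diag D + B - ?\<sigma>" .
    have "2 *\<^sub>R P = (P + Q) + (P - Q)" "2 *\<^sub>R Q = (P + Q) - (P - Q)"
      by (simp_all add: scaleR_2)
    then have "2 *\<^sub>R P = 2 *\<^sub>R (double_diag D + B)" "2 *\<^sub>R Q = 2 *\<^sub>R ?\<sigma>"
      unfolding PQ PQ' by (simp_all add: scaleR_2)
    then have "P = double_diag D + B" "Q = ?\<sigma>"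
      by simp_all
    moreover have "norm (X - mat 1) \<le> C * norm B" "norm (d - D) \<le> C * norm B"
    proof -
      have "p - (mat 1, D) = (X - mat 1, d - D)"
        by (simp add: X_def d_def prod_eq_iff)
      then show "norm (X - mat 1) \<le> C * norm B" "norm (d - D) \<le> C * norm B"
        using p(1) norm_fst_le[of "X - mat 1" "d - D"] norm_snd_le[of "d - D" "X - mat 1"] by auto
    qed
    ultimately show ?thesis
      unfolding P_def Q_def Sp_def by blast
  qed
  then show ?thesis using C \<eta> by blast
qed

section \<open>Symplectic eigenvalues\<close>

lemma map_matrix_of_real_mult:
  "map_matrix complex_of_real (A ** B) = map_matrix complex_of_real A ** map_matrix complex_of_real B"
  by (simp add: vec_eq_iff matrix_matrix_mult_def)

lemma i_sigma_mult:
  "i_sigma M *v v = \<i> *s (map_matrix complex_of_real (symplectic_form ** M) *v v)"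
  by (simp add: i_sigma_def vec_eq_iff matrix_vector_mult_def sum_distrib_left mult.assoc)

text \<open>The eigenvalue equation couples only the components \<open>Inl j\<close> and
  \<open>Inr j\<close> of \<open>w\<close>. Applying it twice multiplies each of them by the square
  of \<open>d $ j\<close>, and some component is nonzero.\<close>

lemma i_sigma_double_diag_eigenvalue:
  fixes d :: "real^'n::finite"
  assumes "w \<noteq> 0" and eq: "i_sigma (double_diag d) *v w = c *s w"
  shows "\<exists>j. c = of_real (d $ j) \<or> c = - of_real (d $ j)"
proof -
  have l: "\<i> * of_real (d $ j) * w $ Inr j = c * w $ Inl j" for j
    using eq[THEN arg_cong, of "\<lambda>v. v $ Inl j"]
    by (simp add: i_sigma_def matrix_matrix_mult_def matrix_vector_mult_def sum_UNIV_Plus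
        if_distrib[of "\<lambda>x. x * c" for c] if_distrib[of "(*) c" for c]
        if_distrib[of complex_of_real] cong: if_cong)
  have r: "- (\<i> * of_real (d $ j) * w $ Inl j) = c * w $ Inr j" for j
    using eq[THEN arg_cong, of "\<lambda>v. v $ Inr j"]
    by (simp add: i_sigma_def matrix_matrix_mult_def matrix_vector_mult_def sum_UNIV_Plus
        if_distrib[of "\<lambda>x. x * c" for c] if_distrib[of "(*) c" for c]
        if_distrib[of complex_of_real] cong: if_cong)
  obtain a where a: "w $ a \<noteq> 0"
    using \<open>w \<noteq> 0\<close> by (auto simp: vec_eq_iff)
  then obtain j where "w $ Inl j \<noteq> 0 \<or> w $ Inr j \<noteq> 0"
    by (cases a) auto
  moreover have "c * c * w $ Inl j = of_real (d $ j) * of_real (d $ j) * w $ Inl j"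
  proof -
    have "c * c * w $ Inl j = \<i> * of_real (d $ j) * (c * w $ Inr j)"
      using l[of j] by (simp add: algebra_simps)
    also have "\<dots> = of_real (d $ j) * of_real (d $ j) * w $ Inl j"
      unfolding r[symmetric] by (simp add: algebra_simps)
    finally show ?thesis .
  qed
  moreover have "c * c * w $ Inr j = of_real (d $ j) * of_real (d $ j) * w $ Inr j"
  proof -
    have "c * c * w $ Inr j = c * (c * w $ Inr j)"
      by simp
    also have "\<dots> = - (\<i> * of_real (d $ j) * (c * w $ Inl j))"
      unfolding r[symmetric] by simp
    also have "\<dots> = of_real (d $ j) * of_real (d $ j) * w $ Inr j"
      unfolding l[symmetric] by (simp add: algebra_simps)
    finally show ?thesis .
  qed
  ultimately have "c * c = of_real (d $ j) * of_real (d $ j)"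
    by auto
  then show ?thesis
    by (auto simp: square_eq_iff)
qed

text \<open>A symplectic congruence of \<open>M\<close> is a similarity of
  \<open>symplectic_form ** M\<close>, because
  \<open>S ** symplectic_form ** transpose S = symplectic_form\<close>. The inverse of
  \<open>S\<close> therefore carries eigenvectors of \<open>i_sigma M\<close> to eigenvectors of
  \<open>i_sigma (double_diag d)\<close> for the same \<open>c\<close>.\<close>

lemma williamson_eigenvalue:
  fixes d :: "real^'n::finite"
  assumes S: "S \<in> Sp" and diag: "transpose S ** M ** S = double_diag d"
    and v: "v \<noteq> 0" "i_sigma M *v v = c *s v"
  shows "\<exists>j. c = of_real (d $ j) \<or> c = - of_real (d $ j)"
proof (rule i_sigma_double_diag_eigenvalue)
  let ?c = "map_matrix complex_of_real"
  let ?R = "symplectic_inverse S"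
  have SR: "?c S *v (?c ?R *v x) = x" for x
  proof -
    have "?c (S ** ?R) = mat 1"
      unfolding symplectic_inverse_right[OF S] by (simp add: vec_eq_iff mat_def)
    then show ?thesis
      by (simp add: map_matrix_of_real_mult matrix_vector_mul_assoc)
  qed
  then show "?c ?R *v v \<noteq> 0"
    using v(1) by (metis matrix_vector_mult_0_right)
  have "S ** (symplectic_form ** double_diag d) = symplectic_form ** M ** S"
    by (simp only: diag[symmetric] matrix_mul_assoc Sp_transpose[OF S])
  then have "?R ** S ** (symplectic_form ** double_diag d) = ?R ** (symplectic_form ** M) ** S"
    by (metis matrix_mul_assoc)
  then have sim: "symplectic_form ** double_diag d = ?R ** (symplectic_form ** M) ** S"
    by (simp add: symplectic_inverse_left[OF S])
  have "?c (symplectic_form ** double_diag d) *v (?c ?R *v v) = ?c ?R *v (?c (symplectic_form ** M) *v v)"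
    unfolding sim map_matrix_of_real_mult by (simp add: matrix_vector_mul_assoc[symmetric] SR)
  then have "i_sigma (double_diag d) *v (?c ?R *v v) = ?c ?R *v (i_sigma M *v v)"
    by (simp add: i_sigma_mult vector_scalar_commute)
  then show "i_sigma (double_diag d) *v (?c ?R *v v) = c *s (?c ?R *v v)"
    by (simp add: v(2) vector_scalar_commute)
qed

text \<open>The \<open>2n\<close> distinct eigenvalues all lie among the \<open>\<plusminus> d $ j\<close>.\<close>

lemma williamson_diagonal_inj:
  fixes d :: "real^'n::finite"
  assumes "S \<in> Sp" "transpose S ** M ** S = double_diag d"
    and lam: "eigenvalue_enum (i_sigma M) lam" and "inj lam"
  shows "inj (($) d)"
proof -
  let ?f = "\<lambda>x::real. of_real x :: complex"
  let ?D = "range (($) d)"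
  have "range lam \<subseteq> ?f ` ?D \<union> (\<lambda>x. - ?f x) ` ?D"
  proof
    fix c assume "c \<in> range lam"
    then obtain v where "v \<noteq> 0" "i_sigma M *v v = c *s v"
      using eigenvalue_enum_range[OF lam] by blast
    from williamson_eigenvalue[OF assms(1,2) this] show "c \<in> ?f ` ?D \<union> (\<lambda>x. - ?f x) ` ?D"
      by blast
  qed
  then have "card (range lam) \<le> card (?f ` ?D \<union> (\<lambda>x. - ?f x) ` ?D)"
    by (intro card_mono) auto
  also have "\<dots> \<le> card (?f ` ?D) + card ((\<lambda>x. - ?f x) ` ?D)"
    by (rule card_Un_le)
  also have "\<dots> \<le> card ?D + card ?D"
    by (intro add_mono card_image_le) auto
  finally have "CARD('n) \<le> card ?D"
    using \<open>inj lam\<close> by (simp add: card_image)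
  then show ?thesis
    using card_image_le[of UNIV "($) d"] by (intro eq_card_imp_inj_on) auto
qed

section \<open>Perturbation of the diagonalising matrix\<close>

text \<open>The perturbation argument measures matrices in the Euclidean norm of their entries; this
  translates its estimates into the operator norm.\<close>

lemma opnorm_le_norm: "\<exists>K>0. \<forall>A :: real^'k::finite^'l::finite. opnorm A \<le> K * norm A"
proof -
  have "bilinear ((*v) :: real^'k^'l \<Rightarrow> real^'k \<Rightarrow> real^'l)"
    unfolding bilinear_def
    by (auto intro!: linearI simp: matrix_vector_mult_def vec_eq_iff algebra_simps sum.distrib sum_distrib_left)
  then obtain K where "0 < K" "\<And>(A :: real^'k^'l) x. norm (A *v x) \<le> norm A * norm x * K"
    using bounded_bilinear.pos_bounded unfolding bilinear_conv_bounded_bilinear by blast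
  then show ?thesis
    unfolding opnorm_def by (intro exI[of _ K]) (auto intro!: onorm_le simp: mult_ac)
qed

text \<open>Finitely many strict inequalities define an open set. The perturbed diagonal therefore
  keeps the order demanded by \<open>williamson_diagonalises\<close>, and no columns have to be
  permuted.\<close>

lemma pos_strict_decreasing_stable:
  fixes D :: "real^'n::{finite,linorder}"
  assumes "\<And>i. 0 < D $ i" and "\<And>i j. i < j \<Longrightarrow> D $ j < D $ i"
  shows "\<exists>r>0. \<forall>d. norm (d - D) < r \<longrightarrow> (\<forall>i. 0 < d $ i) \<and> (\<forall>i j. i \<le> j \<longrightarrow> d $ j \<le> d $ i)"
proof -
  have lim: "((\<lambda>d. d $ i) \<longlongrightarrow> D $ i) (nhds D)" for i
    by (intro tendsto_vec_nth filterlim_ident)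
  have "\<forall>\<^sub>F d in nhds D. 0 < d $ i" for i
    using order_tendstoD(1)[OF lim assms(1)] .
  moreover have "\<forall>\<^sub>F d in nhds D. i < j \<longrightarrow> d $ j < d $ i" for i j
  proof (cases "i < j")
    case True
    have "((\<lambda>d. d $ i - d $ j) \<longlongrightarrow> D $ i - D $ j) (nhds D)"
      by (intro tendsto_diff lim)
    then have "\<forall>\<^sub>F d in nhds D. 0 < d $ i - d $ j"
      using assms(2)[OF True] by (intro order_tendstoD(1)) auto
    then show ?thesis by eventually_elim simp
  qed simp
  ultimately have "\<forall>\<^sub>F d in nhds D. (\<forall>i. 0 < d $ i) \<and> (\<forall>i j. i < j \<longrightarrow> d $ j < d $ i)"
    by (intro eventually_conj eventually_all_finite) auto
  then show ?thesis
    unfolding eventually_nhds_metric dist_norm by (metis order.order_iff_strict)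
qed

lemma williamson_perturbation:
  fixes M S E :: "real^('n::{finite,linorder} + 'n)^('n + 'n)"
  assumes lam: "eigenvalue_enum (i_sigma M) lam" "inj lam"
    and S: "williamson_diagonalises S M" and E: "symmetric_mat E"
  shows "\<exists>L>0. \<exists>\<epsilon>\<^sub>0>0. \<forall>\<epsilon>. 0 < \<epsilon> \<and> \<epsilon> < \<epsilon>\<^sub>0 \<longrightarrow>
    (\<exists>S'. williamson_diagonalises S' (M + \<epsilon> *\<^sub>R E) \<and> opnorm (S - S') \<le> L * \<epsilon>)"
proof -
  have Sp: "S \<in> Sp" using S by (simp add: williamson_diagonalises_def)
  obtain D\<^sub>m where D\<^sub>m: "\<And>i j. i \<noteq> j \<Longrightarrow> D\<^sub>m $ i $ j = 0" "\<And>i j. i \<le> j \<Longrightarrow> D\<^sub>m $ j $ j \<le> D\<^sub>m $ i $ i"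
    "\<And>i. 0 < D\<^sub>m $ i $ i" "transpose S ** M ** S = block_matrix D\<^sub>m 0 0 D\<^sub>m"
    using S unfolding williamson_diagonalises_def by blast
  define D where "D = (\<chi> i. D\<^sub>m $ i $ i)"
  have pos: "0 < D $ i" for i
    using D\<^sub>m by (simp add: D_def)
  have "block_matrix D\<^sub>m 0 0 D\<^sub>m = double_diag D"
    by (rule matrix_eq_sumI) (auto simp: block_matrix_def D_def D\<^sub>m(1))
  then have diag: "transpose S ** M ** S = double_diag D"
    using D\<^sub>m(4) by simp
  have inj: "inj (($) D)"
    using williamson_diagonal_inj[OF Sp diag lam] .
  \<comment> \<open>Nondegeneracy upgrades the weak order of the diagonal entries to a strict one,
    which survives perturbation.\<close>
  have "D $ j < D $ i" if "i < j" for i j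
    using D\<^sub>m(2)[of i j] that injD[OF inj, of i j] by (force simp: D_def)
  then obtain r where r: "0 < r"
    "\<And>d. norm (d - D) < r \<Longrightarrow> (\<forall>i. 0 < d $ i) \<and> (\<forall>i j. i \<le> j \<longrightarrow> d $ j \<le> d $ i)"
    using pos_strict_decreasing_stable[OF pos] by metis
  define F where "F = transpose S ** E ** S"
  have F: "symmetric_mat F"
    using E by (simp add: F_def symmetric_mat_def matrix_transpose_mul matrix_mul_assoc)
  obtain C \<eta> where C: "0 < C" and \<eta>: "0 < \<eta>"
    and sol: "\<And>B. symmetric_mat B \<Longrightarrow> norm B \<le> \<eta> \<Longrightarrow>
      \<exists>X d. norm (X - mat 1) \<le> C * norm B \<and> norm (d - D) \<le> C * norm B \<and> X \<in> Sp \<and>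
        transpose X ** double_diag d ** X = double_diag D + B"
    using symplectic_diagonalisation_perturbation[OF pos inj] by metis
  \<comment> \<open>\<open>G (X - mat 1)\<close> equals
    \<open>S - S ** symplectic_inverse X\<close>, since \<open>symplectic_form\<close> squares to
    \<open>- mat 1\<close>.\<close>
  define G where "G Y = S ** (symplectic_form ** transpose Y ** symplectic_form)"
    for Y :: "real^('n + 'n)^('n + 'n)"
  have "linear G"
    by (rule linearI) (simp_all add: G_def transpose_simps matrix_mult_simps)
  then obtain c where c: "0 < c" "\<And>Y. norm (G Y) \<le> c * norm Y"
    using linear_bounded_pos by blast
  obtain K where K: "0 < K" "\<And>A :: real^('n + 'n)^('n + 'n). opnorm A \<le> K * norm A"
    using opnorm_le_norm by blast
  \<comment> \<open>The summand 1 keeps \<open>N\<close> positive even if \<open>norm F = 0\<close>.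
    Of the two bounds in \<open>\<epsilon>\<^sub>0\<close>, the first makes the perturbation
    \<open>\<epsilon> *\<^sub>R F\<close> admissible, and the second keeps \<open>d\<close> within
    distance \<open>r\<close> of \<open>D\<close>.\<close>
  define N where "N = norm F + 1"
  have N: "0 < N" by (simp add: N_def add_nonneg_pos)
  define \<epsilon>\<^sub>0 where "\<epsilon>\<^sub>0 = min (\<eta> / N) (r / (C * N))"
  have "\<exists>S'. williamson_diagonalises S' (M + \<epsilon> *\<^sub>R E) \<and> opnorm (S - S') \<le> K * c * C * N * \<epsilon>"
    if \<epsilon>: "0 < \<epsilon>" "\<epsilon> < \<epsilon>\<^sub>0" for \<epsilon>
  proof -
    have small: "norm (\<epsilon> *\<^sub>R F) \<le> N * \<epsilon>"
      using \<epsilon>(1) by (simp add: N_def algebra_simps)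
    also have "N * \<epsilon> < \<eta>"
      using \<epsilon>(2) N by (simp add: \<epsilon>\<^sub>0_def field_simps)
    finally have "norm (\<epsilon> *\<^sub>R F) \<le> \<eta>" by simp
    moreover have "symmetric_mat (\<epsilon> *\<^sub>R F)"
      using F by (simp add: symmetric_mat_def transpose_simps)
    ultimately obtain X d where X: "norm (X - mat 1) \<le> C * norm (\<epsilon> *\<^sub>R F)" "X \<in> Sp"
      and d: "norm (d - D) \<le> C * norm (\<epsilon> *\<^sub>R F)"
      and Xd: "transpose X ** double_diag d ** X = double_diag D + \<epsilon> *\<^sub>R F"
      using sol by blast
    have CN: "C * norm (\<epsilon> *\<^sub>R F) \<le> C * (N * \<epsilon>)"
      using small C by (simp only: mult_le_cancel_left_pos)
    have "C * (N * \<epsilon>) < r"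
      using \<epsilon>(2) N C by (simp add: \<epsilon>\<^sub>0_def field_simps)
    then have order: "\<And>i. 0 < d $ i" "\<And>i j. i \<le> j \<Longrightarrow> d $ j \<le> d $ i"
      using r(2)[of d] d CN by auto
    let ?T = "symplectic_inverse X"
    have "transpose ?T ** (double_diag D + \<epsilon> *\<^sub>R F) ** ?T = double_diag d"
      using transpose_mult_inverse_cancel[OF Xd symplectic_inverse_right[OF X(2)]] .
    moreover have "double_diag D + \<epsilon> *\<^sub>R F = transpose S ** (M + \<epsilon> *\<^sub>R E) ** S"
      by (simp add: diag[symmetric] F_def matrix_mult_simps)
    ultimately have "transpose (S ** ?T) ** (M + \<epsilon> *\<^sub>R E) ** (S ** ?T) = double_diag d"
      by (simp add: matrix_transpose_mul matrix_mul_assoc)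
    then have W: "williamson_diagonalises (S ** ?T) (M + \<epsilon> *\<^sub>R E)"
      unfolding williamson_diagonalises_def double_diag_def
      using Sp_mult[OF Sp symplectic_inverse_Sp[OF X(2)]] order
      by (intro conjI exI[of _ "\<chi> i j. if i = j then d $ i else 0"]) auto
    have "S - S ** ?T = G (X - mat 1)"
      by (simp add: G_def symplectic_inverse_def transpose_simps matrix_mult_simps symplectic_form_square)
    then have "opnorm (S - S ** ?T) \<le> K * norm (G (X - mat 1))"
      using K(2) by metis
    also have "\<dots> \<le> K * (c * (C * (N * \<epsilon>)))"
    proof (intro mult_left_mono)
      have "norm (G (X - mat 1)) \<le> c * norm (X - mat 1)" by (rule c(2))
      also have "\<dots> \<le> c * (C * (N * \<epsilon>))"
        using c(1) X(1) CN by (intro mult_left_mono) auto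
      finally show "norm (G (X - mat 1)) \<le> c * (C * (N * \<epsilon>))" .
    qed (use K(1) in simp)
    finally have "opnorm (S - S ** ?T) \<le> K * c * C * N * \<epsilon>"
      by (simp add: mult.assoc)
    with W show ?thesis by blast
  qed
  moreover have "0 < K * c * C * N" "0 < \<epsilon>\<^sub>0"
    using K c C N r(1) \<eta> by (simp_all add: \<epsilon>\<^sub>0_def)
  ultimately show ?thesis by blast
qed

section \<open>Comparison of the linear rate with the square-root bound\<close>

theorem proposition4p1:
  fixes M S E :: "real^('n::{finite,linorder} + 'n)^('n + 'n)"
    and lam :: "'n + 'n \<Rightarrow> complex"
    and \<delta> :: real
  assumes "pos_def M"
    and "eigenvalue_enum (i_sigma M) lam"
    and "inj lam"
    and "\<delta> = Min {cmod (lam i - lam j) | i j. i \<noteq> j}"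
    and "williamson_diagonalises S M"
    and "symmetric_mat E"
    and "opnorm E = 1"
  shows "\<exists>\<epsilon>\<^sub>0>0. \<forall>\<epsilon>. 0 < \<epsilon> \<and> \<epsilon> < \<epsilon>\<^sub>0 \<and> pos_def (M + \<epsilon> *\<^sub>R E) \<longrightarrow>
    (\<exists>S\<^sub>\<epsilon>. williamson_diagonalises S\<^sub>\<epsilon> (M + \<epsilon> *\<^sub>R E) \<and>
       opnorm (S - S\<^sub>\<epsilon>) <
         4 * (sqrt (condition_number M)
              + sqrt (real CARD('n) ^ 3 * opnorm M / opnorm (matrix_inv M)) / (2 * \<delta>))
           * opnorm (pos_def_sqrt (matrix_inv M)) * sqrt \<epsilon>)"
proof -
  have M': "pos_def (matrix_inv M)"
    using pos_def_matrix_inv[OF assms(1)] .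
  have norms: "0 < opnorm M" "0 < opnorm (matrix_inv M)" "0 < opnorm (pos_def_sqrt (matrix_inv M))"
    using opnorm_pos_def_pos assms(1) M' pos_def_sqrt(1)[OF M'] by blast+
  have "0 \<le> \<delta>"
  proof -
    let ?A = "{cmod (lam i - lam j) | i j. i \<noteq> j}"
    have "?A \<subseteq> (\<lambda>(i, j). cmod (lam i - lam j)) ` UNIV" by auto
    then have "finite ?A" by (rule finite_subset) simp
    \<comment> \<open>A pair of distinct indices that exists for every \<open>n\<close>, so the
      minimum is over a nonempty set.\<close>
    moreover have "cmod (lam (Inl undefined) - lam (Inr undefined)) \<in> ?A" by blast
    ultimately show ?thesis
      unfolding assms(4) by (subst Min_ge_iff) auto
  qed
  define k where "k = 4 * (sqrt (condition_number M)
      + sqrt (real CARD('n) ^ 3 * opnorm M / opnorm (matrix_inv M)) / (2 * \<delta>))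
    * opnorm (pos_def_sqrt (matrix_inv M))"
  have "0 < sqrt (condition_number M)"
    using norms by (simp add: condition_number_def)
  moreover have "0 \<le> sqrt (real CARD('n) ^ 3 * opnorm M / opnorm (matrix_inv M)) / (2 * \<delta>)"
    using norms \<open>0 \<le> \<delta>\<close> by simp
  ultimately have k: "0 < k"
    unfolding k_def using norms(3) by (intro mult_pos_pos add_pos_nonneg) auto
  obtain L \<epsilon>\<^sub>0 where L: "0 < L" and \<epsilon>\<^sub>0: "0 < \<epsilon>\<^sub>0"
    and pert: "\<And>\<epsilon>. 0 < \<epsilon> \<Longrightarrow> \<epsilon> < \<epsilon>\<^sub>0 \<Longrightarrow>
      \<exists>S'. williamson_diagonalises S' (M + \<epsilon> *\<^sub>R E) \<and> opnorm (S - S') \<le> L * \<epsilon>"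
    using williamson_perturbation[OF assms(2,3,5,6)] by blast
  \<comment> \<open>\<open>L * \<epsilon>\<close> falls below \<open>k * sqrt \<epsilon>\<close>
    exactly when \<open>sqrt \<epsilon> < k / L\<close>, hence the threshold
    \<open>(k / L)\<^sup>2\<close>.\<close>
  have "\<exists>S'. williamson_diagonalises S' (M + \<epsilon> *\<^sub>R E) \<and> opnorm (S - S') < k * sqrt \<epsilon>"
    if \<epsilon>: "0 < \<epsilon>" "\<epsilon> < min \<epsilon>\<^sub>0 ((k / L)\<^sup>2)" for \<epsilon>
  proof -
    have "sqrt \<epsilon> < k / L"
      using \<epsilon> k L by (intro real_less_lsqrt) auto
    then have "L * sqrt \<epsilon> * sqrt \<epsilon> < k * sqrt \<epsilon>"
      using L \<epsilon>(1) by (intro mult_strict_right_mono) (auto simp: field_simps)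
    then have "L * \<epsilon> < k * sqrt \<epsilon>"
      using \<epsilon>(1) by (simp add: mult.assoc)
    then show ?thesis
      using pert[of \<epsilon>] \<epsilon> by (meson min_less_iff_conj le_less_trans)
  qed
  moreover have "0 < min \<epsilon>\<^sub>0 ((k / L)\<^sup>2)"
    using \<epsilon>\<^sub>0 k L by simp
  ultimately show ?thesis
    unfolding k_def by blast
qed

end
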